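(* Let $\mathcal{H}$ and $\mathcal{G}$ be real Hilbert spaces, $f:\mathcal{H}\to\overline{\mathbb{R}}$ and $g:\mathcal{G}\to\overline{\mathbb{R}}$ proper, convex and lower semicontinuous functions, $h:\mathcal{H}\to\mathbb{R}$ a convex and Fréchet differentiable function with $L$-Lipschitz continuous gradient (where $L\ge 0$), and $A:\mathcal{H}\to\mathcal{G}$ a linear continuous operator. Let $c>0$, let $M_1^k\in\mathcal{S}_+(\mathcal{H})$ and $M_2^k\in\mathcal{S}_+(\mathcal{G})$ for all $k\ge0$, and assume that $$M_1^k-L\,\mathrm{Id}\in\mathcal{S}_+(\mathcal{H}),\quad M_1^k\succcurlyeq M_1^{k+1},\quad M_2^k\succcurlyeq M_2^{k+1}\quad\text{for all } k\ge0.$$ Let $(x^k,z^k,y^k)_{k\ge0}$ be the sequence generated by the variable metric ADMM algorithm described in the context. For all $k\ge1$ define the ergodic sequences $$\overline{x}^k:=\frac1k\sum_{i=1}^k x^i,\quad \overline{y}^k:=\frac1k\sum_{i=1}^k y^i,\quad \overline{z}^k:=\frac1k\sum_{i=1}^k z^i.$$ Then for all $k\ge1$ and all $(x,z,y)\in\mathcal{H}\times\mathcal{G}\times\mathcal{G}$ it holds $$l(\overline{x}^k,\overline{z}^k,y)-l(x,z,\overline{y}^k)\le\frac{\gamma(x,z,y)}{k},$$ where $$\gamma(x,z,y):=\frac{c}{2}\|Ax-z^0\|^2+\frac12\left(\|x-x^0\|_{M_1^0}^2+\|z-z^0\|_{M_2^0}^2\right)+\frac{1}{2c}\|y-y^0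\|^2.$$
   Context: Here $\overline{\mathbb{R}}=\mathbb{R}\cup\{\pm\infty\}$. The Lagrangian is $l:\mathcal{H}\times\mathcal{G}\times\mathcal{G}\to\overline{\mathbb{R}}$, $l(x,z,y)=f(x)+h(x)+g(z)+\langle y,Ax-z\rangle$ (associated with the problem $\inf_{x\in\mathcal{H}}\{f(x)+h(x)+g(Ax)\}$). $\mathcal{S}_+(\mathcal{H})$ denotes the family of linear, continuous, self-adjoint and positive semidefinite operators $U:\mathcal{H}\to\mathcal{H}$ (similarly $\mathcal{S}_+(\mathcal{G})$). For $U\in\mathcal{S}_+(\mathcal{H})$, $\|x\|_U^2=\langle x,Ux\rangle$. For $U_1,U_2\in\mathcal{S}_+(\mathcal{H})$, $U_1\succcurlyeq U_2$ means $\|x\|_{U_1}^2\ge\|x\|_{U_2}^2$ for all $x\in\mathcal{H}$. $\mathrm{Id}$ is the identity operator. Variable metric ADMM algorithm: choose $(x^0,z^0,y^0)\in\mathcal{H}\times\mathcal{G}\times\mathcal{G}$ and $c>0$, and for all $k\ge0$ let $$x^{k+1}\in\operatorname{argmin}_{x\in\mathcal{H}}\left\{f(x)+\langle x-x^k,\nabla h(x^k)\rangle+\frac{c}{2}\|Ax-z^k+c^{-1}y^k\|^2+\frac12\|x-x^k\|_{M_1^k}^2\right\},$$ $$z^{k+1}=\operatorname{argmin}_{z\in\mathcal{G}}\left\{g(z)+\frac{c}{2}\|Ax^{k+1}-z+c^{-1}y^k\|^2+\frac12\|z-z^k\|_{M_2^k}^2\right\},$$ $$y^{k+1}=y^k+c(Ax^{k+1}-z^{k+1}).$$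 A sequence generated by the algorithm is any sequence satisfying these relations for all $k\ge0$. *)

theory Defs
  imports "HOL-Analysis.Analysis"
begin

definition ereal_proper :: "('a \<Rightarrow> ereal) \<Rightarrow> bool" where
  "ereal_proper f \<longleftrightarrow> (\<forall>x. f x \<noteq> -\<infinity>) \<and> (\<exists>x. f x \<noteq> \<infinity>)"

text \<open>Convexity is stated through the (real) epigraph, which avoids expressions
  of the form \<open>\<infinity> - \<infinity>\<close>; the library constant \<open>epigraph\<close> only covers real-valued functions.\<close>

definition ereal_convex :: "('a::real_vector \<Rightarrow> ereal) \<Rightarrow> bool" where
  "ereal_convex f \<longleftrightarrow> convex {(x, r::real). f x \<le> ereal r}"

definition lower_semicont :: "('a::topological_space \<Rightarrow> ereal) \<Rightarrow> bool" where
  "lower_semicont f \<longleftrightarrow> (\<forall>x. f x \<le> Liminf (nhds x) f)"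

definition argmin :: "('a \<Rightarrow> ereal) \<Rightarrow> 'a set" where
  "argmin F = {x. is_arg_min F (\<lambda>_. True) x}"

text \<open>The library constant \<open>adjoint\<close> is only meaningful once an adjoint is known to exist,
  so self-adjointness is stated with the inner product.\<close>

definition S_plus :: "('a::real_inner \<Rightarrow>\<^sub>L 'a) set" where
  "S_plus = {U :: 'a \<Rightarrow>\<^sub>L 'a. (\<forall>x y. U x \<bullet> y = x \<bullet> U y) \<and> (\<forall>x. 0 \<le> x \<bullet> U x)}"

definition sqnorm :: "('a::real_inner \<Rightarrow>\<^sub>L 'a) \<Rightarrow> 'a \<Rightarrow> real" where
  "sqnorm U x = x \<bullet> U x"

definition op_ge :: "('a::real_inner \<Rightarrow>\<^sub>L 'a) \<Rightarrow> ('a \<Rightarrow>\<^sub>L 'a) \<Rightarrow> bool"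
    (infix \<open>\<succeq>\<close> 50) where
  "U\<^sub>1 \<succeq> U\<^sub>2 \<longleftrightarrow> (\<forall>x. sqnorm U\<^sub>1 x \<ge> sqnorm U\<^sub>2 x)"

definition lagrangian ::
  "('a::real_inner \<Rightarrow> ereal) \<Rightarrow> ('a \<Rightarrow> real) \<Rightarrow> ('b::real_inner \<Rightarrow> ereal) \<Rightarrow> ('a \<Rightarrow>\<^sub>L 'b)
    \<Rightarrow> 'a \<Rightarrow> 'b \<Rightarrow> 'b \<Rightarrow> ereal" where
  "lagrangian f h g A x z y = f x + ereal (h x) + g z + ereal (y \<bullet> (A x - z))"

text \<open>The argument \<open>grad_h\<close> is the gradient map of the smooth term. The \<open>z\<close>-step asserts
  that the minimiser is unique, whereas the \<open>x\<close>-step only picks some minimiser.\<close>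

definition vm_admm ::
  "('a::real_inner \<Rightarrow> ereal) \<Rightarrow> ('a \<Rightarrow> 'a) \<Rightarrow> ('b::real_inner \<Rightarrow> ereal) \<Rightarrow> ('a \<Rightarrow>\<^sub>L 'b) \<Rightarrow> real
    \<Rightarrow> (nat \<Rightarrow> 'a \<Rightarrow>\<^sub>L 'a) \<Rightarrow> (nat \<Rightarrow> 'b \<Rightarrow>\<^sub>L 'b)
    \<Rightarrow> (nat \<Rightarrow> 'a) \<Rightarrow> (nat \<Rightarrow> 'b) \<Rightarrow> (nat \<Rightarrow> 'b) \<Rightarrow> bool" where
  "vm_admm f grad_h g A c M\<^sub>1 M\<^sub>2 xs zs ys \<longleftrightarrow>
    (\<forall>k.
      xs (Suc k) \<in> argmin (\<lambda>x. f x + ereal ((x - xs k) \<bullet> grad_h (xs k)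
          + c / 2 * (norm (A x - zs k + (1 / c) *\<^sub>R ys k))\<^sup>2
          + 1 / 2 * sqnorm (M\<^sub>1 k) (x - xs k))) \<and>
      {zs (Suc k)} = argmin (\<lambda>z. g z + ereal (
          c / 2 * (norm (A (xs (Suc k)) - z + (1 / c) *\<^sub>R ys k))\<^sup>2
          + 1 / 2 * sqnorm (M\<^sub>2 k) (z - zs k))) \<and>
      ys (Suc k) = ys k + c *\<^sub>R (A (xs (Suc k)) - zs (Suc k)))"

definition ergodic :: "(nat \<Rightarrow> 'a::real_vector) \<Rightarrow> nat \<Rightarrow> 'a" where
  "ergodic u k = (1 / real k) *\<^sub>R (\<Sum>i = 1..k. u i)"

end

theory Submission
  imports Defs
begin

text \<open>The two optimality conditions, the descent lemma for \<open>h\<close> and the dual update bound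
  the gap \<open>l(x\<^sup>k\<^sup>+\<^sup>1, z\<^sup>k\<^sup>+\<^sup>1, y) - l(x, z, y\<^sup>k\<^sup>+\<^sup>1)\<close> of one iteration by
  \<open>\<gamma>\<^sub>k - \<gamma>\<^sub>k\<^sub>+\<^sub>1\<close>, where \<open>\<gamma>\<^sub>k\<close> is \<open>\<gamma>(x, z, y)\<close> formed with the \<open>k\<close>-th iterates and metrics.
  Summing telescopes, and the Lagrangian is convex in \<open>(x, z)\<close> and affine in \<open>y\<close>,
  so averaging gives the ergodic estimate.\<close>

section \<open>Second-order expansions of the quadratic terms\<close>

lemma sqnorm_add_scaleR:
  assumes "U \<in> S_plus"
  shows "sqnorm U (u + t *\<^sub>R v) = sqnorm U u + t * (2 * (v \<bullet> U u)) + t\<^sup>2 * sqnorm U v"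
proof -
  have "u \<bullet> U v = v \<bullet> U u"
    using assms by (simp add: S_plus_def inner_commute)
  then show ?thesis
    by (simp add: sqnorm_def blinfun.add_right blinfun.scaleR_right inner_simps
        power2_eq_square algebra_simps)
qed

text \<open>This is the expansion at \<open>t = 1\<close>, since
  \<open>(p - q) + (x - p) = x - q\<close>. It turns the cross term of an optimality condition into
  squared distances from \<open>x\<close>, which later telescope, and a remainder
  \<open>sqnorm U (p - q)\<close>.\<close>

lemma sqnorm_three_point:
  assumes "U \<in> S_plus"
  shows "(x - p) \<bullet> U (p - q) = 1 / 2 * (sqnorm U (x - q) - sqnorm U (x - p) - sqnorm U (p - q))"
  using sqnorm_add_scaleR[OF assms, of "p - q" 1 "x - p"] by simp

lemma norm_sq_add_scaleR:
  fixes u v :: "'a::real_inner"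
  shows "(norm (u + t *\<^sub>R v))\<^sup>2 = (norm u)\<^sup>2 + t * (2 * (v \<bullet> u)) + t\<^sup>2 * (norm v)\<^sup>2"
  unfolding power2_norm_eq_inner
  by (simp add: inner_simps inner_commute power2_eq_square algebra_simps)

section \<open>Minimisers of a convex function plus a quadratic\<close>

lemma argmin_proper_finite:
  assumes "ereal_proper \<phi>" "p \<in> argmin (\<lambda>u. \<phi> u + ereal (q u))"
  shows "\<bar>\<phi> p\<bar> \<noteq> \<infinity>"
proof -
  obtain u where u: "\<phi> u \<noteq> \<infinity>" and minf: "\<phi> p \<noteq> -\<infinity>" "\<phi> u \<noteq> -\<infinity>"
    using assms(1) by (auto simp: ereal_proper_def)
  have "\<not> \<phi> u + ereal (q u) < \<phi> p + ereal (q p)"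
    using assms(2) by (simp add: argmin_def is_arg_min_def)
  then show ?thesis
    using u minf by (cases "\<phi> u"; cases "\<phi> p") auto
qed

text \<open>A move from \<open>p\<close> towards \<open>x\<close> by a fraction \<open>t\<close>
  raises \<open>\<phi>\<close> by at most \<open>t * (b - a)\<close>, by convexity, and changes
  \<open>q\<close> by \<open>t * l (x - p) + t\<^sup>2 * r (x - p)\<close>. Minimality makes the
  total nonnegative; after division by \<open>t\<close>, small \<open>t\<close> leaves the
  first-order part. This stands in for Fermat's rule with a subdifferential.\<close>

lemma argmin_variational_inequality:
  fixes \<phi> :: "'a::real_vector \<Rightarrow> ereal"
  assumes "ereal_proper \<phi>" "ereal_convex \<phi>" "p \<in> argmin (\<lambda>u. \<phi> u + ereal (q u))"
    and q: "\<And>d t. q (p + t *\<^sub>R d) = q p + t * l d + t\<^sup>2 * r d"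
    and a: "\<phi> p = ereal a" and b: "\<phi> x = ereal b"
  shows "a \<le> b + l (x - p)"
proof (rule ccontr)
  define s R where "s = a - b - l (x - p)" and "R = r (x - p)"
  \<comment> \<open>This choice gives \<open>t * \<bar>R\<bar> < s\<close> for \<open>s > 0\<close>,
    so a single explicit step length replaces the limit of \<open>t\<close> to 0.\<close>
  define t where "t = s / (s + \<bar>R\<bar>)"
  assume "\<not> ?thesis"
  then have s: "s > 0"
    by (simp add: s_def)
  then have t: "0 < t" "t \<le> 1"
    by (auto simp: t_def)
  have "(1 - t) *\<^sub>R (p, a) + t *\<^sub>R (x, b) \<in> {(x, r::real). \<phi> x \<le> ereal r}"
    using assms(2) t unfolding ereal_convex_def
    by (intro convexD) (auto simp: a b)
  moreover have "(1 - t) *\<^sub>R p + t *\<^sub>R x = p + t *\<^sub>R (x - p)"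
    by (simp add: algebra_simps)
  ultimately have "\<phi> (p + t *\<^sub>R (x - p)) \<le> ereal ((1 - t) * a + t * b)"
    by simp
  then have "\<phi> (p + t *\<^sub>R (x - p)) + ereal (q (p + t *\<^sub>R (x - p)))
      \<le> ereal ((1 - t) * a + t * b) + ereal (q (p + t *\<^sub>R (x - p)))"
    by (rule add_right_mono)
  moreover have "\<phi> p + ereal (q p) \<le> \<phi> (p + t *\<^sub>R (x - p)) + ereal (q (p + t *\<^sub>R (x - p)))"
    using assms(3) by (simp add: argmin_def is_arg_min_def not_less)
  ultimately have "a + q p \<le> (1 - t) * a + t * b + q (p + t *\<^sub>R (x - p))"
    unfolding a by (metis (no_types, lifting) order_trans plus_ereal.simps(1) ereal_less_eq(3))
  then have "t * s \<le> t * (t * R)"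
    unfolding q by (simp add: s_def R_def algebra_simps power2_eq_square)
  then have "s \<le> t * R"
    using t by simp
  also have "\<dots> \<le> t * \<bar>R\<bar>"
    using t by (intro mult_left_mono) auto
  also have "\<dots> < s"
    using s by (simp add: t_def field_simps)
  finally show False
    by simp
qed

section \<open>Tangent and descent inequalities for the smooth term\<close>

lemma gderiv_along_line:
  assumes "GDERIV h (u + t *\<^sub>R v) :> D"
  shows "((\<lambda>t. h (u + t *\<^sub>R v)) has_real_derivative v \<bullet> D) (at t)"
proof -
  have "((\<lambda>t. u + t *\<^sub>R v) has_derivative (\<lambda>s. s *\<^sub>R v)) (at t)"
    by (auto intro!: derivative_eq_intros)
  from has_derivative_compose[OF this assms[unfolded gderiv_def]] show ?thesis
    by (simp add: has_field_derivative_def mult_commute_abs)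
qed

text \<open>The restriction of \<open>h\<close> to the line through \<open>u\<close> and
  \<open>x\<close> is convex, and its tangent inequality at parameter 0, read at parameter 1, is the
  claim.\<close>

lemma convex_on_above_tangent_gderiv:
  fixes h :: "'a::real_inner \<Rightarrow> real"
  assumes "convex_on UNIV h" "GDERIV h u :> D"
  shows "h u + (x - u) \<bullet> D \<le> h x"
proof -
  let ?\<phi> = "\<lambda>t::real. h (u + t *\<^sub>R (x - u))"
  have "convex_on UNIV ?\<phi>"
  proof (rule convex_onI)
    fix t a b :: real assume "0 < t" "t < 1"
    moreover have "u + ((1 - t) *\<^sub>R a + t *\<^sub>R b) *\<^sub>R (x - u)
        = (1 - t) *\<^sub>R (u + a *\<^sub>R (x - u)) + t *\<^sub>R (u + b *\<^sub>R (x - u))"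
      by (simp add: algebra_simps)
    ultimately show "?\<phi> ((1 - t) *\<^sub>R a + t *\<^sub>R b) \<le> (1 - t) * ?\<phi> a + t * ?\<phi> b"
      using convex_onD[OF assms(1), of t] by simp
  qed simp
  moreover have "(?\<phi> has_real_derivative (x - u) \<bullet> D) (at 0)"
    by (rule gderiv_along_line) (simp add: assms(2))
  ultimately have "?\<phi> 1 - ?\<phi> 0 \<ge> ((x - u) \<bullet> D) * (1 - 0)"
    by (intro convex_on_imp_above_tangent[where A = UNIV]) auto
  then show ?thesis
    by simp
qed

text \<open>No integral of the gradient is formed: along the segment from \<open>u\<close> to
  \<open>x\<close>, \<open>h\<close> minus its proposed quadratic bound has nonpositive derivative,
  by Cauchy-Schwarz and the Lipschitz bound, and comparing the endpoints gives the claim.\<close>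

lemma descent_lemma:
  fixes h :: "'a::real_inner \<Rightarrow> real"
  assumes grad: "\<And>x. GDERIV h x :> grad_h x" and lip: "L-lipschitz_on UNIV grad_h"
  shows "h x \<le> h u + (x - u) \<bullet> grad_h u + L / 2 * (norm (x - u))\<^sup>2"
proof -
  let ?d = "x - u"
  let ?\<psi> = "\<lambda>t. h (u + t *\<^sub>R ?d) - t * (?d \<bullet> grad_h u) - L / 2 * t\<^sup>2 * (norm ?d)\<^sup>2"
  have "?\<psi> 1 \<le> ?\<psi> 0"
  proof (rule DERIV_nonpos_imp_nonincreasing[where f = ?\<psi>])
    fix t :: real assume t: "0 \<le> t" "t \<le> 1"
    let ?D = "?d \<bullet> grad_h (u + t *\<^sub>R ?d) - ?d \<bullet> grad_h u - L * t * (norm ?d)\<^sup>2"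
    have "((\<lambda>t. h (u + t *\<^sub>R ?d)) has_real_derivative ?d \<bullet> grad_h (u + t *\<^sub>R ?d)) (at t)"
      by (rule gderiv_along_line) (rule grad)
    then have "(?\<psi> has_real_derivative ?D) (at t)"
      by (auto intro!: derivative_eq_intros)
    moreover have "?D \<le> 0"
    proof -
      have "?d \<bullet> (grad_h (u + t *\<^sub>R ?d) - grad_h u)
          \<le> norm ?d * norm (grad_h (u + t *\<^sub>R ?d) - grad_h u)"
        by (rule norm_cauchy_schwarz)
      also have "\<dots> \<le> norm ?d * (L * norm (t *\<^sub>R ?d))"
        using lipschitz_onD[OF lip, of "u + t *\<^sub>R ?d" u]
        by (intro mult_left_mono) (simp_all add: dist_norm)
      finally show ?thesis
        using t by (simp add: inner_diff_right power2_eq_square mult_ac)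
    qed
    ultimately show "\<exists>y. (?\<psi> has_real_derivative y) (at t) \<and> y \<le> 0"
      by blast
  qed simp
  then show ?thesis
    by simp
qed

section \<open>Jensen's inequality for ergodic averages\<close>

text \<open>The averaged points \<open>(u i, v i)\<close> stay in the convex epigraph. Finiteness is
  asked from index 1 on only, because the starting point of the algorithm may lie outside the
  domain.\<close>

lemma ereal_convex_ergodic_le:
  assumes "ereal_convex \<phi>" "k \<ge> 1" "\<And>i. \<phi> (u (Suc i)) = ereal (v (Suc i))"
  shows "\<phi> (ergodic u k) \<le> ereal (ergodic v k)"
proof -
  have "(\<Sum>i = 1..k. (1 / real k) *\<^sub>R (u i, v i)) \<in> {(x, r::real). \<phi> x \<le> ereal r}"
  proof (rule convex_sum)
    show "convex {(x, r::real). \<phi> x \<le> ereal r}"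
      using assms(1) by (simp add: ereal_convex_def)
    show "(u i, v i) \<in> {(x, r). \<phi> x \<le> ereal r}" if "i \<in> {1..k}" for i
      using assms(3)[of "i - 1"] that by simp
  qed (use assms(2) in auto)
  moreover have "(\<Sum>i = 1..k. (1 / real k) *\<^sub>R (u i, v i)) = (ergodic u k, ergodic v k)"
    unfolding ergodic_def by (simp add: sum_prod sum_divide_distrib scaleR_sum_right)
  ultimately show ?thesis
    by simp
qed

section \<open>Estimates for one iteration\<close>

text \<open>The linearisation of \<open>h\<close> at \<open>xk\<close> is traded for
  \<open>h\<close> itself: the tangent inequality handles \<open>h x\<close>, the descent lemma
  handles \<open>h p\<close>. The descent error is absorbed by the term
  \<open>sqnorm M (p - xk)\<close> of the three-point identity, which is where positivity of
  \<open>M - L *\<^sub>R id_blinfun\<close> enters.\<close>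

lemma vm_admm_x_step:
  fixes f :: "'a::real_inner \<Rightarrow> ereal" and zk yk :: "'b::real_inner"
  assumes "ereal_proper f" "ereal_convex f"
    and "convex_on UNIV h" "\<And>x. GDERIV h x :> grad_h x" "L-lipschitz_on UNIV grad_h"
    and "M \<in> S_plus" "M - L *\<^sub>R id_blinfun \<in> S_plus"
    and "p \<in> argmin (\<lambda>x. f x + ereal ((x - xk) \<bullet> grad_h xk
          + c / 2 * (norm (blinfun_apply A x - zk + w))\<^sup>2 + 1 / 2 * sqnorm M (x - xk)))"
    and "f p = ereal a" "f x = ereal b"
  shows "a + h p \<le> b + h x + c * (A (x - p) \<bullet> (A p - zk + w))
      + 1 / 2 * (sqnorm M (x - xk) - sqnorm M (x - p))"
proof -
  let ?q = "\<lambda>x. (x - xk) \<bullet> grad_h xk + c / 2 * (norm (A x - zk + w))\<^sup>2 + 1 / 2 * sqnorm M (x - xk)"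
  \<comment> \<open>\<open>?l\<close> is the directional derivative of the quadratic part
    \<open>?q\<close> at \<open>p\<close>, and \<open>?r\<close> its second-order
    coefficient.\<close>
  let ?l = "\<lambda>d. d \<bullet> grad_h xk + c * (A d \<bullet> (A p - zk + w)) + d \<bullet> M (p - xk)"
  let ?r = "\<lambda>d. c / 2 * (norm (A d))\<^sup>2 + 1 / 2 * sqnorm M d"
  have "a \<le> b + ?l (x - p)"
  proof (rule argmin_variational_inequality[where q = ?q and l = ?l and r = ?r and \<phi> = f])
    fix d t
    have "(norm (A (p + t *\<^sub>R d) - zk + w))\<^sup>2
        = (norm (A p - zk + w))\<^sup>2 + t * (2 * (A d \<bullet> (A p - zk + w))) + t\<^sup>2 * (norm (A d))\<^sup>2"
      using norm_sq_add_scaleR[of "A p - zk + w" t "A d"]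
      by (simp add: blinfun.add_right blinfun.scaleR_right algebra_simps)
    moreover have "sqnorm M (p + t *\<^sub>R d - xk)
        = sqnorm M (p - xk) + t * (2 * (d \<bullet> M (p - xk))) + t\<^sup>2 * sqnorm M d"
      using sqnorm_add_scaleR[OF assms(6), of "p - xk" t d] by (simp add: algebra_simps)
    moreover have "(p + t *\<^sub>R d - xk) \<bullet> grad_h xk = (p - xk) \<bullet> grad_h xk + t * (d \<bullet> grad_h xk)"
      by (simp add: inner_simps)
    ultimately show "?q (p + t *\<^sub>R d) = ?q p + t * ?l d + t\<^sup>2 * ?r d"
      by (simp only:) (simp add: algebra_simps)
  qed (use assms in auto)
  moreover have "h p \<le> h xk + (p - xk) \<bullet> grad_h xk + L / 2 * (norm (p - xk))\<^sup>2"
    using descent_lemma[OF assms(4,5)] .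
  moreover have "h xk + (x - xk) \<bullet> grad_h xk \<le> h x"
    using convex_on_above_tangent_gderiv[OF assms(3,4)] .
  moreover have "(x - xk) \<bullet> grad_h xk = (x - p) \<bullet> grad_h xk + (p - xk) \<bullet> grad_h xk"
    by (simp add: inner_simps)
  moreover have "L * (norm (p - xk))\<^sup>2 \<le> sqnorm M (p - xk)"
  proof -
    have "0 \<le> (p - xk) \<bullet> (M - L *\<^sub>R id_blinfun) (p - xk)"
      using assms(7) by (simp add: S_plus_def)
    then show ?thesis
      by (simp add: sqnorm_def blinfun.diff_left blinfun.scaleR_left inner_diff_right
          power2_norm_eq_inner del: inner_diff_left)
  qed
  moreover note sqnorm_three_point[OF assms(6), of x p xk]
  ultimately show ?thesis
    by (simp add: diff_divide_distrib)
qed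

text \<open>The argument of the \<open>x\<close>-step without a smooth term; the nonnegative
  remainder of the three-point identity is simply dropped. The variable enters the penalty with a
  minus sign, hence the sign before \<open>c\<close>.\<close>

lemma vm_admm_z_step:
  fixes g :: "'b::real_inner \<Rightarrow> ereal" and v w zk :: 'b
  assumes "ereal_proper g" "ereal_convex g" "M \<in> S_plus"
    and "p \<in> argmin (\<lambda>z. g z + ereal (c / 2 * (norm (v - z + w))\<^sup>2 + 1 / 2 * sqnorm M (z - zk)))"
    and "g p = ereal a" "g z = ereal b"
  shows "a \<le> b - c * ((z - p) \<bullet> (v - p + w)) + 1 / 2 * (sqnorm M (z - zk) - sqnorm M (z - p))"
proof -
  let ?q = "\<lambda>z. c / 2 * (norm (v - z + w))\<^sup>2 + 1 / 2 * sqnorm M (z - zk)"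
  let ?l = "\<lambda>d. - c * (d \<bullet> (v - p + w)) + d \<bullet> M (p - zk)"
  let ?r = "\<lambda>d. c / 2 * (norm d)\<^sup>2 + 1 / 2 * sqnorm M d"
  have "a \<le> b + ?l (z - p)"
  proof (rule argmin_variational_inequality[where q = ?q and l = ?l and r = ?r and \<phi> = g])
    fix d t
    have "(norm (v - (p + t *\<^sub>R d) + w))\<^sup>2
        = (norm (v - p + w))\<^sup>2 + t * (- 2 * (d \<bullet> (v - p + w))) + t\<^sup>2 * (norm d)\<^sup>2"
      using norm_sq_add_scaleR[of "v - p + w" "- t" d] by (simp add: algebra_simps)
    moreover have "sqnorm M (p + t *\<^sub>R d - zk)
        = sqnorm M (p - zk) + t * (2 * (d \<bullet> M (p - zk))) + t\<^sup>2 * sqnorm M d"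
      using sqnorm_add_scaleR[OF assms(3), of "p - zk" t d] by (simp add: algebra_simps)
    ultimately show "?q (p + t *\<^sub>R d) = ?q p + t * ?l d + t\<^sup>2 * ?r d"
      by (simp only:) (simp add: algebra_simps)
  qed (use assms in auto)
  moreover have "0 \<le> sqnorm M (p - zk)"
    using assms(3) by (simp add: S_plus_def sqnorm_def)
  moreover note sqnorm_three_point[OF assms(3), of z p zk]
  ultimately show ?thesis
    by (simp add: diff_divide_distrib)
qed

text \<open>Here \<open>a\<close>, \<open>p'\<close>, \<open>z\<close>, \<open>z'\<close>,
  \<open>w\<close>, \<open>y'\<close> play the roles of \<open>A x\<close>, the new
  \<open>A x\<close>-iterate, the old and new \<open>z\<close>-iterates, and the old and new
  multipliers. By the dual update \<open>c * (p' - z' + w / c)\<close> is \<open>y'\<close>, so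
  \<open>b\<close> cancels; what remains is two telescoping differences and a negative
  square.\<close>

lemma vm_admm_coupling_identity:
  fixes a p z p' z' y y' w :: "'b::real_inner"
  assumes "c > 0" "y' = w + c *\<^sub>R (p' - z')"
  shows "c * ((a - p') \<bullet> (p' - z + (1 / c) *\<^sub>R w)) - c * ((b - z') \<bullet> (p' - z' + (1 / c) *\<^sub>R w))
      + y \<bullet> (p' - z') - y' \<bullet> (a - b)
    = c / 2 * ((norm (a - z))\<^sup>2 - (norm (a - z'))\<^sup>2 - (norm (p' - z))\<^sup>2)
      + 1 / (2 * c) * ((norm (y - w))\<^sup>2 - (norm (y - y'))\<^sup>2)"
proof -
  \<comment> \<open>Rescaling the old multiplier makes both multipliers multiples of
    \<open>c\<close>, so the identity becomes polynomial in \<open>c\<close>.\<close>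
  define q where "q = (1 / c) *\<^sub>R w"
  have w: "w = c *\<^sub>R q"
    using assms(1) by (simp add: q_def)
  have y': "y' = c *\<^sub>R (q + (p' - z'))"
    by (simp add: assms(2) w algebra_simps)
  have "(norm (y - w))\<^sup>2 - (norm (y - y'))\<^sup>2
      = 2 * c * (y \<bullet> (p' - z') - c * (q \<bullet> (p' - z')) - c / 2 * ((p' - z') \<bullet> (p' - z')))"
    unfolding w y' power2_norm_eq_inner
    by (simp add: inner_simps inner_commute power2_eq_square algebra_simps)
  then have "1 / (2 * c) * ((norm (y - w))\<^sup>2 - (norm (y - y'))\<^sup>2)
      = y \<bullet> (p' - z') - c * (q \<bullet> (p' - z')) - c / 2 * ((p' - z') \<bullet> (p' - z'))"
    using assms(1) by simp
  then show ?thesis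
    unfolding q_def[symmetric] unfolding y' power2_norm_eq_inner
    by (simp add: inner_simps inner_commute algebra_simps add_divide_distrib diff_divide_distrib)
qed

section \<open>Averaging the Lagrangian and the ergodic estimate\<close>

text \<open>Jensen's inequality applies to \<open>f\<close>, \<open>h\<close> and \<open>g\<close>
  separately, while the coupling term is linear in the primal pair and averages exactly.\<close>

lemma lagrangian_ergodic_le:
  fixes f :: "'a::real_inner \<Rightarrow> ereal" and g :: "'b::real_inner \<Rightarrow> ereal"
  assumes "ereal_convex f" "ereal_convex g"
    and "convex_on UNIV h" "k \<ge> 1"
    and fx: "\<And>i. f (xs (Suc i)) = ereal (a (Suc i))" and gz: "\<And>i. g (zs (Suc i)) = ereal (b (Suc i))"
  shows "lagrangian f h g A (ergodic xs k) (ergodic zs k) y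
    \<le> ereal (ergodic (\<lambda>i. a i + h (xs i) + b i + y \<bullet> (A (xs i) - zs i)) k)"
proof -
  have "ereal_convex (\<lambda>x. ereal (h x))"
    using assms(3) convex_epigraph[of UNIV h]
    by (simp add: ereal_convex_def epigraph_def case_prod_unfold)
  then have "ereal (h (ergodic xs k)) \<le> ereal (ergodic (\<lambda>i. h (xs i)) k)"
    by (rule ereal_convex_ergodic_le[OF _ assms(4)]) simp
  moreover have "f (ergodic xs k) \<le> ereal (ergodic a k)" "g (ergodic zs k) \<le> ereal (ergodic b k)"
    using ereal_convex_ergodic_le[OF _ assms(4)] assms(1,2) fx gz by blast+
  ultimately have "lagrangian f h g A (ergodic xs k) (ergodic zs k) y
      \<le> ereal (ergodic a k) + ereal (ergodic (\<lambda>i. h (xs i)) k) + ereal (ergodic b k)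
        + ereal (y \<bullet> (A (ergodic xs k) - ergodic zs k))"
    unfolding lagrangian_def by (intro add_mono order_refl)
  also have "y \<bullet> (A (ergodic xs k) - ergodic zs k) = ergodic (\<lambda>i. y \<bullet> (A (xs i) - zs i)) k"
    unfolding ergodic_def
    by (simp add: blinfun.scaleR_right blinfun.sum_right inner_diff_right inner_sum_right
        sum_subtractf right_diff_distrib)
  finally show ?thesis
    by (simp add: ergodic_def sum.distrib add_divide_distrib)
qed

theorem theorem12:
  fixes f :: "'a::{real_inner, complete_space} \<Rightarrow> ereal"
    and g :: "'b::{real_inner, complete_space} \<Rightarrow> ereal"
    and h :: "'a \<Rightarrow> real"
    and grad_h :: "'a \<Rightarrow> 'a"
    and L c :: real
    and A :: "'a \<Rightarrow>\<^sub>L 'b"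
    and M\<^sub>1 :: "nat \<Rightarrow> 'a \<Rightarrow>\<^sub>L 'a"
    and M\<^sub>2 :: "nat \<Rightarrow> 'b \<Rightarrow>\<^sub>L 'b"
    and xs :: "nat \<Rightarrow> 'a"
    and zs ys :: "nat \<Rightarrow> 'b"
  assumes "ereal_proper f" "ereal_convex f" "lower_semicont f"
    and "ereal_proper g" "ereal_convex g" "lower_semicont g"
    and "convex_on UNIV h"
    and "\<And>x. GDERIV h x :> grad_h x"
    and "0 \<le> L" "L-lipschitz_on UNIV grad_h"
    and "0 < c"
    and "\<And>k. M\<^sub>1 k \<in> S_plus" "\<And>k. M\<^sub>2 k \<in> S_plus"
    and "\<And>k. M\<^sub>1 k - L *\<^sub>R id_blinfun \<in> S_plus"
    and "\<And>k. M\<^sub>1 k \<succeq> M\<^sub>1 (Suc k)" "\<And>k. M\<^sub>2 k \<succeq> M\<^sub>2 (Suc k)"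
    and "vm_admm f grad_h g A c M\<^sub>1 M\<^sub>2 xs zs ys"
  defines "\<gamma> \<equiv> \<lambda>x z y. c / 2 * (norm (A x - zs 0))\<^sup>2
      + 1 / 2 * (sqnorm (M\<^sub>1 0) (x - xs 0) + sqnorm (M\<^sub>2 0) (z - zs 0))
      + 1 / (2 * c) * (norm (y - ys 0))\<^sup>2"
  shows "\<forall>k\<ge>1. \<forall>x z y.
    lagrangian f h g A (ergodic xs k) (ergodic zs k) y - lagrangian f h g A x z (ergodic ys k)
      \<le> ereal (\<gamma> x z y / real k)"
proof (intro allI impI)
  fix k :: nat and x z y
  assume k: "1 \<le> k"
  \<comment> \<open>At index 0 the function value may be infinite and \<open>real_of_ereal\<close>
    then returns 0; the ergodic sums start at index 1, where \<open>fx\<close> and \<open>gz\<close>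
    give finiteness.\<close>
  define a where "a i = real_of_ereal (f (xs i))" for i
  define b where "b i = real_of_ereal (g (zs i))" for i
  define F where "F i = a i + h (xs i) + b i + y \<bullet> (A (xs i) - zs i)" for i
  have x_min: "xs (Suc i) \<in> argmin (\<lambda>x. f x + ereal ((x - xs i) \<bullet> grad_h (xs i)
          + c / 2 * (norm (A x - zs i + (1 / c) *\<^sub>R ys i))\<^sup>2
          + 1 / 2 * sqnorm (M\<^sub>1 i) (x - xs i)))"
    and z_min: "zs (Suc i) \<in> argmin (\<lambda>z. g z + ereal (
          c / 2 * (norm (A (xs (Suc i)) - z + (1 / c) *\<^sub>R ys i))\<^sup>2
          + 1 / 2 * sqnorm (M\<^sub>2 i) (z - zs i)))"
    and y_step: "ys (Suc i) = ys i + c *\<^sub>R (A (xs (Suc i)) - zs (Suc i))" for i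
    using assms(17) unfolding vm_admm_def by blast+
  have fx: "f (xs (Suc i)) = ereal (a (Suc i))" and gz: "g (zs (Suc i)) = ereal (b (Suc i))" for i
    using argmin_proper_finite[OF assms(1) x_min] argmin_proper_finite[OF assms(4) z_min]
    by (simp_all add: a_def b_def ereal_real')
  have avg: "lagrangian f h g A (ergodic xs k) (ergodic zs k) y \<le> ereal (ergodic F k)"
    unfolding F_def using assms(2,5,7) k fx gz by (rule lagrangian_ergodic_le)
  show "lagrangian f h g A (ergodic xs k) (ergodic zs k) y - lagrangian f h g A x z (ergodic ys k)
      \<le> ereal (\<gamma> x z y / real k)"
  \<comment> \<open>In \<open>ereal\<close>, \<infinity> - \<infinity> is \<infinity>, so if the
    second Lagrangian value is infinite the claim rests on \<open>avg\<close>, which keeps the first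
    one below \<infinity>.\<close>
  proof (cases "f x = \<infinity> \<or> g z = \<infinity>")
    case True
    moreover have "f x \<noteq> -\<infinity>" "g z \<noteq> -\<infinity>"
      using assms(1,4) by (auto simp: ereal_proper_def)
    ultimately have "lagrangian f h g A x z (ergodic ys k) = \<infinity>"
      by (auto simp: lagrangian_def)
    then show ?thesis
      using avg by (cases "lagrangian f h g A (ergodic xs k) (ergodic zs k) y") auto
  next
    case False
    then obtain fr gr where fr: "f x = ereal fr" and gr: "g z = ereal gr"
      using assms(1,4) unfolding ereal_proper_def by (metis ereal_cases)
    define G where "G i = fr + h x + gr + ys i \<bullet> (A x - z)" for i
    define \<Gamma> where "\<Gamma> i = c / 2 * (norm (A x - zs i))\<^sup>2
      + 1 / 2 * (sqnorm (M\<^sub>1 i) (x - xs i) + sqnorm (M\<^sub>2 i) (z - zs i))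
      + 1 / (2 * c) * (norm (y - ys i))\<^sup>2" for i
    have step: "F (Suc i) - G (Suc i) \<le> \<Gamma> i - \<Gamma> (Suc i)" for i
    proof -
      \<comment> \<open>The one-step estimates carry the old metrics at the new iterates;
        monotonicity exchanges them for the new metrics, as telescoping requires.\<close>
      have "sqnorm (M\<^sub>1 (Suc i)) (x - xs (Suc i)) \<le> sqnorm (M\<^sub>1 i) (x - xs (Suc i))"
        "sqnorm (M\<^sub>2 (Suc i)) (z - zs (Suc i)) \<le> sqnorm (M\<^sub>2 i) (z - zs (Suc i))"
        using assms(15,16) by (auto simp: op_ge_def)
      \<comment> \<open>Splitting \<open>A (x - xs (Suc i))\<close> makes the inner product agree
        with the one in the coupling identity.\<close>
      moreover note vm_admm_x_step[OF assms(1,2,7,8,10,12,14) x_min fx fr, of i, unfolded blinfun.diff_right]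
      moreover note vm_admm_z_step[OF assms(4,5,13) z_min gz gr, of i]
      moreover note vm_admm_coupling_identity[OF assms(11) y_step[of i], of "A x" "zs i" z y]
      \<comment> \<open>This discards the negative square left by the coupling identity.\<close>
      moreover have "0 \<le> c * (norm (A (xs (Suc i)) - zs i))\<^sup>2"
        using assms(11) by simp
      ultimately show ?thesis
        unfolding F_def G_def \<Gamma>_def right_diff_distrib distrib_left by linarith
    qed
    have "0 \<le> \<Gamma> k"
      using assms(11-13) by (auto simp: \<Gamma>_def S_plus_def sqnorm_def intro!: add_nonneg_nonneg)
    have "(\<Sum>i = 1..k. F i) - (\<Sum>i = 1..k. G i) = (\<Sum>i<k. F (Suc i) - G (Suc i))"
      by (simp add: sum_subtractf sum.atLeast1_atMost_eq)
    also have "\<dots> \<le> (\<Sum>i<k. \<Gamma> i - \<Gamma> (Suc i))"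
      by (intro sum_mono step)
    also have "\<dots> = \<Gamma> 0 - \<Gamma> k"
      by (rule sum_lessThan_telescope')
    finally have "(\<Sum>i = 1..k. F i) - (\<Sum>i = 1..k. G i) \<le> \<gamma> x z y"
      using \<open>0 \<le> \<Gamma> k\<close> by (simp add: \<Gamma>_def \<gamma>_def)
    then have "ergodic F k - ergodic G k \<le> \<gamma> x z y / real k"
      by (simp add: ergodic_def diff_divide_distrib[symmetric] divide_right_mono)
    moreover have "lagrangian f h g A x z (ergodic ys k) = ereal (ergodic G k)"
    proof -
      \<comment> \<open>\<open>G\<close> is affine in the multiplier, and for
        \<open>k \<ge> 1\<close> the average of its constant part is that constant.\<close>
      have "ergodic G k = fr + h x + gr + ergodic ys k \<bullet> (A x - z)"
        using k by (simp add: ergodic_def G_def sum.distrib inner_sum_left field_simps)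
      then show ?thesis
        by (simp add: lagrangian_def fr gr)
    qed
    ultimately show ?thesis
      using avg by (cases "lagrangian f h g A (ergodic xs k) (ergodic zs k) y") auto
  qed
qed

end
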